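(* (i) For every linear hypergraph $\mathcal H=(V,\mathcal E)$ with $V\notin\mathcal E$ there is a hypergraph $\mathcal H'=(V,\mathcal E')$ with $EI(\mathcal H')=\mathcal H$. (ii) Let $\mathcal H=(V,\mathcal E)$ be a hypergraph containing hyperedges $e_1,e_2\in\mathcal E$ with $|e_1\cap e_2|\ge 2$, $e_1\not\subseteq e_2$ and $e_2\not\subseteq e_1$, and let $\mathcal H'=(V,\mathcal E')$ be a hypergraph with $\mathcal H=EI(\mathcal H')$. Then there is a hyperedge $\tilde e\in\mathcal E\setminus\{e_1,e_2\}$ with $e_1\cap e_2\subseteq\tilde e$. (iii) Not every hypergraph $\mathcal H=(V,\mathcal E)$ with $V\notin\mathcal E$ is the edge intersection hypergraph $EI(\mathcal H')$ of some hypergraph $\mathcal H'=(V,\mathcal E')$.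
   Context: A hypergraph $\mathcal H=(V,\mathcal E)$ consists of a finite vertex set $V$ and a set $\mathcal E$ of subsets of $V$ (hyperedges); there are no multiple hyperedges and no loops (no hyperedges of cardinality $1$). $\mathcal H$ is linear if any two distinct hyperedges share at most one vertex. The edge intersection hypergraph of $\mathcal H=(V,\mathcal E)$ is $EI(\mathcal H)=(V,\mathcal E^{EI})$ with $\mathcal E^{EI}=\{e_1\cap e_2 \mid e_1,e_2\in\mathcal E,\ e_1\neq e_2,\ |e_1\cap e_2|\ge 2\}$.
   Formalization: Hyperedges are required to be nonempty (so each has at least two vertices); if the empty hyperedge were allowed, (i) would fail, e.g. for V={1}, E={∅}, since every hyperedge of EI(H') has at least two vertices. *)

theory Defs
  imports Main
begin

type_synonym 'a hypergraph = "'a set \<times> 'a set set"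

(* Hyperedges are nonempty, as usual for hypergraphs; together with the exclusion
   of loops (singletons) this says that every hyperedge has at least two vertices. *)
definition hypergraph :: "'a hypergraph \<Rightarrow> bool" where
  "hypergraph H \<longleftrightarrow> (case H of (V, E) \<Rightarrow> finite V \<and> (\<forall>e\<in>E. e \<subseteq> V \<and> e \<noteq> {} \<and> card e \<noteq> 1))"

definition linear_hypergraph :: "'a hypergraph \<Rightarrow> bool" where
  "linear_hypergraph H \<longleftrightarrow>
     hypergraph H \<and> (case H of (V, E) \<Rightarrow> \<forall>e1\<in>E. \<forall>e2\<in>E. e1 \<noteq> e2 \<longrightarrow> card (e1 \<inter> e2) \<le> 1)"

definition EI :: "'a hypergraph \<Rightarrow> 'a hypergraph" where
  "EI H = (case H of (V, E) \<Rightarrow>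
     (V, {e1 \<inter> e2 | e1 e2. e1 \<in> E \<and> e2 \<in> E \<and> e1 \<noteq> e2 \<and> card (e1 \<inter> e2) \<ge> 2}))"

end

(* For (i), add V itself as a hyperedge: e \<inter> V = e recovers every hyperedge, and by linearity
   no other intersection is large. For (ii), pick p in e1 - e2 and q in e2 - e1. As e1 and e2 are
   intersections of hyperedges of H', some hyperedge a of H' contains e1 but not q, and some b
   contains e2 but not p; then a \<inter> b contains e1 \<inter> e2 and misses both p and q. For (iii), apply
   (ii) to two triples meeting in two points. *)

theory Submission
  imports Defs
begin

lemma hypergraph_edge_card:
  assumes "hypergraph (V, E)" "e \<in> E"
  shows "2 \<le> card e"
proof -
  have "finite V" "e \<subseteq> V" "e \<noteq> {}" "card e \<noteq> 1"
    using assms by (auto simp: hypergraph_def)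
  \<comment> \<open>\<open>card\<close> is also 0 on infinite sets, so nonemptiness suffices only
    because \<open>e\<close> is finite as a subset of \<open>V\<close>.\<close>
  moreover from this have "card e \<noteq> 0"
    by (meson card_eq_0_iff finite_subset)
  ultimately show ?thesis by linarith
qed

lemma EI_insert_vertex_set:
  assumes lin: "linear_hypergraph (V, E)" and V: "V \<notin> E"
  shows "EI (V, insert V E) = (V, E)"
proof -
  have hyp: "hypergraph (V, E)"
    using lin by (simp add: linear_hypergraph_def)
  then have sub: "e \<inter> V = e" "V \<inter> e = e" if "e \<in> E" for e
    using that by (auto simp: hypergraph_def)
  have small: "\<not> 2 \<le> card (e1 \<inter> e2)" if "e1 \<in> E" "e2 \<in> E" "e1 \<noteq> e2" for e1 e2
    using lin that by (fastforce simp: linear_hypergraph_def)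
  have "e1 \<inter> e2 \<in> E"
    if e: "e1 \<in> insert V E" "e2 \<in> insert V E" "e1 \<noteq> e2" and "2 \<le> card (e1 \<inter> e2)" for e1 e2
  proof -
    \<comment> \<open>By linearity, two distinct members of \<open>E\<close> meet in at most one
      vertex, so an intersection this large must involve \<open>V\<close>.\<close>
    have "e1 = V \<or> e2 = V"
      using that small[of e1 e2] by blast
    then show ?thesis
      using e sub by auto
  qed
  moreover have "\<exists>e1 e2. e = e1 \<inter> e2 \<and> e1 \<in> insert V E \<and> e2 \<in> insert V E \<and>
      e1 \<noteq> e2 \<and> 2 \<le> card (e1 \<inter> e2)" if "e \<in> E" for e
    \<comment> \<open>The witnesses are \<open>e\<close> and \<open>V\<close>: they differ because
      \<open>V \<notin> E\<close>, and their intersection \<open>e\<close> has at least two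
      vertices.\<close>
    using that V sub(1)[OF that] hypergraph_edge_card[OF hyp that]
    by (intro exI[of _ e] exI[of _ V]) auto
  ultimately have "{e1 \<inter> e2 | e1 e2. e1 \<in> insert V E \<and> e2 \<in> insert V E \<and> e1 \<noteq> e2 \<and>
      2 \<le> card (e1 \<inter> e2)} = E"
    by (intro subset_antisym subsetI CollectI) (elim CollectE exE conjE, simp)
  then show ?thesis
    by (simp only: EI_def prod.case)
qed

text \<open>Adding \<open>V\<close> must not create an empty edge or a loop. Any edge of
  \<open>E\<close> forces \<open>V\<close> to have at least two vertices; without edges
  \<open>V\<close> may be too small, and the empty edge set serves instead.\<close>

lemma linear_hypergraph_is_EI:
  assumes lin: "linear_hypergraph (V, E)" and V: "V \<notin> E"
  shows "\<exists>E'. hypergraph (V, E') \<and> EI (V, E') = (V, E)"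
proof (cases "E = {}")
  case True
  then show ?thesis
    using lin by (intro exI[of _ "{}"]) (auto simp: linear_hypergraph_def hypergraph_def EI_def)
next
  case False
  then obtain e where e: "e \<in> E" by blast
  have hyp: "hypergraph (V, E)"
    using lin by (simp add: linear_hypergraph_def)
  then have "card e \<le> card V"
    using e by (auto simp: hypergraph_def intro: card_mono)
  then have "2 \<le> card V"
    using hypergraph_edge_card[OF hyp e] by linarith
  then have "hypergraph (V, insert V E)"
    using hyp by (auto simp: hypergraph_def)
  then show ?thesis
    using EI_insert_vertex_set[OF lin V] by blast
qed

lemma EI_incomparable_edges:
  assumes hyp: "hypergraph (V, E')" and EI: "(V, E) = EI (V, E')"
    and e1: "e1 \<in> E" and e2: "e2 \<in> E" and card: "2 \<le> card (e1 \<inter> e2)"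
    and inc: "\<not> e1 \<subseteq> e2" "\<not> e2 \<subseteq> e1"
  shows "\<exists>e \<in> E - {e1, e2}. e1 \<inter> e2 \<subseteq> e"
proof -
  have E: "E = {a \<inter> b | a b. a \<in> E' \<and> b \<in> E' \<and> a \<noteq> b \<and> 2 \<le> card (a \<inter> b)}"
    using EI by (simp add: EI_def)
  obtain p q where p: "p \<in> e1" "p \<notin> e2" and q: "q \<in> e2" "q \<notin> e1"
    using inc by blast
  \<comment> \<open>Both members of \<open>E'\<close> whose intersection is \<open>e1\<close>
    contain \<open>e1\<close>; since \<open>q\<close> is outside \<open>e1\<close>, at least one of
    them misses \<open>q\<close>.\<close>
  have "\<exists>a \<in> E'. e1 \<subseteq> a \<and> q \<notin> a"
    using e1 q(2) unfolding E by blast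
  then obtain a where a: "a \<in> E'" "e1 \<subseteq> a" "q \<notin> a" by blast
  have "\<exists>b \<in> E'. e2 \<subseteq> b \<and> p \<notin> b"
    using e2 p(2) unfolding E by blast
  then obtain b where b: "b \<in> E'" "e2 \<subseteq> b" "p \<notin> b" by blast
  \<comment> \<open>Monotonicity of \<open>card\<close> needs the larger set
    \<open>a \<inter> b\<close> to be finite.\<close>
  have "finite a"
    using hyp a(1) by (auto simp: hypergraph_def intro: finite_subset)
  moreover have sub: "e1 \<inter> e2 \<subseteq> a \<inter> b"
    using a b by blast
  ultimately have "2 \<le> card (a \<inter> b)"
    using card card_mono[OF _ sub] by fastforce
  \<comment> \<open>The vertex \<open>p\<close> lies in \<open>e1 \<subseteq> a\<close> but not in
    \<open>b\<close>.\<close>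
  moreover have "a \<noteq> b"
    using p a b by blast
  ultimately have "a \<inter> b \<in> E"
    using a(1) b(1) unfolding E by blast
  moreover have "a \<inter> b \<noteq> e1" "a \<inter> b \<noteq> e2"
    using p(1) b(3) q(1) a(3) by auto
  ultimately show ?thesis
    using sub by blast
qed

lemma two_triples_not_EI:
  fixes E :: "nat set set"
  defines "E \<equiv> {{0, 1, 2}, {1, 2, 3}}"
  shows "hypergraph ({0, 1, 2, 3}, E)" "{0, 1, 2, 3} \<notin> E"
    "\<not> (\<exists>E'. hypergraph ({0, 1, 2, 3}, E') \<and> EI ({0, 1, 2, 3}, E') = ({0, 1, 2, 3}, E))"
proof -
  show "hypergraph ({0, 1, 2, 3}, E)"
    by (auto simp: hypergraph_def E_def)
  have "{0, 1, 2, 3} \<noteq> {0, 1, 2 :: nat}" "{0, 1, 2, 3} \<noteq> {1, 2, 3 :: nat}"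
    by (simp_all add: set_eq_iff) presburger+
  then show "{0, 1, 2, 3} \<notin> E"
    by (simp add: E_def)
  show "\<not> (\<exists>E'. hypergraph ({0, 1, 2, 3}, E') \<and> EI ({0, 1, 2, 3}, E') = ({0, 1, 2, 3}, E))"
  proof
    assume "\<exists>E'. hypergraph ({0, 1, 2, 3}, E') \<and> EI ({0, 1, 2, 3}, E') = ({0, 1, 2, 3}, E)"
    then obtain E' where E': "hypergraph ({0, 1, 2, 3}, E')"
      "({0, 1, 2, 3}, E) = EI ({0, 1, 2, 3}, E')" by metis
    have "{0, 1, 2} \<inter> {1, 2, 3 :: nat} = {1, 2}" by auto
    then have "2 \<le> card ({0, 1, 2} \<inter> {1, 2, 3 :: nat})" by simp
    moreover have "{0, 1, 2} \<in> E" "{1, 2, 3} \<in> E"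
      by (simp_all add: E_def)
    moreover have "\<not> {0, 1, 2} \<subseteq> {1, 2, 3 :: nat}" "\<not> {1, 2, 3} \<subseteq> {0, 1, 2 :: nat}"
      by simp_all
    ultimately have "\<exists>e \<in> E - {{0, 1, 2}, {1, 2, 3}}. {0, 1, 2} \<inter> {1, 2, 3} \<subseteq> e"
      using EI_incomparable_edges[OF E'] by metis
    \<comment> \<open>Removing the two triples from \<open>E\<close> leaves no edge that could
      contain their intersection.\<close>
    then show False by (simp add: E_def)
  qed
qed

text \<open>The negative part is stated over \<open>nat\<close> because over a type with at most
  three elements every hypergraph with \<open>V \<notin> E\<close> is linear, so no counterexample
  exists there.\<close>

theorem theorem1:
  "(\<forall>(V :: 'a set) E. linear_hypergraph (V, E) \<and> V \<notin> E \<longrightarrow>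
      (\<exists>E'. hypergraph (V, E') \<and> EI (V, E') = (V, E)))
   \<and>
   (\<forall>(V :: 'a set) E e1 e2 E'.
      hypergraph (V, E) \<and> e1 \<in> E \<and> e2 \<in> E \<and> card (e1 \<inter> e2) \<ge> 2 \<and>
      \<not> e1 \<subseteq> e2 \<and> \<not> e2 \<subseteq> e1 \<and>
      hypergraph (V, E') \<and> (V, E) = EI (V, E') \<longrightarrow>
      (\<exists>e \<in> E - {e1, e2}. e1 \<inter> e2 \<subseteq> e))
   \<and>
   \<not> (\<forall>(V :: nat set) E. hypergraph (V, E) \<and> V \<notin> E \<longrightarrow>
      (\<exists>E'. hypergraph (V, E') \<and> EI (V, E') = (V, E)))"
proof (intro conjI)
  show "\<forall>(V :: 'a set) E. linear_hypergraph (V, E) \<and> V \<notin> E \<longrightarrow>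
      (\<exists>E'. hypergraph (V, E') \<and> EI (V, E') = (V, E))"
    using linear_hypergraph_is_EI by blast
  show "\<forall>(V :: 'a set) E e1 e2 E'.
      hypergraph (V, E) \<and> e1 \<in> E \<and> e2 \<in> E \<and> card (e1 \<inter> e2) \<ge> 2 \<and>
      \<not> e1 \<subseteq> e2 \<and> \<not> e2 \<subseteq> e1 \<and>
      hypergraph (V, E') \<and> (V, E) = EI (V, E') \<longrightarrow>
      (\<exists>e \<in> E - {e1, e2}. e1 \<inter> e2 \<subseteq> e)"
    by (intro allI impI, elim conjE, rule EI_incomparable_edges)
  show "\<not> (\<forall>(V :: nat set) E. hypergraph (V, E) \<and> V \<notin> E \<longrightarrow>
      (\<exists>E'. hypergraph (V, E') \<and> EI (V, E') = (V, E)))"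
    using two_triples_not_EI by metis
qed

end
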